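(* Let $\Gamma$ be an s-theory and let $\phi$ be an s-formula. Then $\phi$ is a strict consequence of $\Gamma$ if and only if there is a closed tableau for $\Gamma\cup\{-\phi\}$.
   Context: Fix an infinite (possibly uncountable) set $\Sigma$ of propositional variables. Propositional formulas are built from $\Sigma$ using $\lnot$, $\land$, $\lor$, $\to$. An s-formula is an expression of the form $A \prec B$ (a strict implication) or $A \not\prec B$ (a strict nonimplication), where $A$ and $B$ are propositional formulas; $\prec$ and $\not\prec$ are two formal symbols, not nested. An s-theory is an arbitrary (possibly infinite) set of s-formulas. The strict negation $-\phi$ of an s-formula $\phi$ is defined by: $-(A\prec B)$ is $A\not\prec B$, and $-(A\not\prec B)$ is $A\prec B$. A valuation is a function $w:\Sigma\to\{T,F\}$, extended in the usual way to all propositional formulas. A frame is a nonempty set of valuations. A frame $R$ satisfies $A \prec B$ if for every $w\in R$, $w(A)=F$ or $w(B)=T$. A frame $R$ satisfies $A\not\prec B$ if there is some $w\in R$ with $w(A)=T$ and $w(B)=F$. A frame satisfies an s-theory if it satisfies every member. An s-formula $\phi$ is a strict consequence of an s-theory $\Gamma$ if every frame that satisfies $\Gamma$ satisfies $\phi$. Fix an infinite set $W$ of world variables. A tableau formula is either an s-formula or an expression $(A,w)$ with $A$ a propositional formula and $w\in W$. A tableau for a set $\Gamma$ of tableau formulas is a finite tree whose nodes are labeled by (possibly infinite) sets of tableau formulas, whose root is labeled $\Gamma$, and in which the children of each non-leaf node are obtained from that node by one of the following rules. Below, $\Delta$ is any set of tableau formulas, "$\Delta,\varphi$" means $\Delta\cup\{\varphi\}$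 ($\Delta$ may itself contain $\varphi$), the label of the parent is on the left of $\Rightarrow$ and the labels of its one or two children (separated by $\mid$) are on the right: - ($\lor$) $\Delta,(A\lor B,w)\Rightarrow \Delta,(A,w)\mid \Delta,(B,w)$ - ($\lnot\lor$) $\Delta,(\lnot(A\lor B),w)\Rightarrow \Delta,(\lnot A,w),(\lnot B,w)$ - ($\land$) $\Delta,(A\land B,w)\Rightarrow \Delta,(A,w),(B,w)$ - ($\lnot\land$) $\Delta,(\lnot(A\land B),w)\Rightarrow \Delta,(\lnot A,w)\mid \Delta,(\lnot B,w)$ - ($\to$) $\Delta,(A\to B,w)\Rightarrow \Delta,(\lnot A,w)\mid\Delta,(B,w)$ - ($\lnot\to$) $\Delta,(\lnot(A\to B),w)\Rightarrow\Delta,(A,w),(\lnot B,w)$ - ($\prec$) $\Delta, A\prec B\Rightarrow \Delta,(\lnot A,w)\mid\Delta,(B,w)$, for any $w\in W$ - ($\not\prec$) $\Delta, A\not\prec B\Rightarrow \Delta,(A,v),(\lnot B,v)$, where $v\in W$ is new: it is not mentioned in the label of the node where the rule is applied or of any of its ancestors - ($C$) $\Delta\Rightarrow \Delta,(A,w)\mid\Delta,(\lnot A,w)$, for any propositional formula $A$ and $w\in W$ - ($\lnot\lnot$) $\Delta,(\lnot\lnot A,w)\Rightarrow\Delta,(A,w)$. A branch is closed if it contains a node whose label contains both $(A,w)$ and $(\lnot A,w)$ for some propositional formula $A$ and some $w\in W$. A tableau is closed if every maximal branch is closed. *)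

theory Defs
  imports Main
begin

datatype 'a form =
    Atom 'a
  | Neg "'a form"
  | Conj "'a form" "'a form"
  | Disj "'a form" "'a form"
  | Imp "'a form" "'a form"

datatype 'a sform =
    StrictImp "'a form" "'a form"
  | StrictNonimp "'a form" "'a form"

primrec sneg :: "'a sform \<Rightarrow> 'a sform" where
  "sneg (StrictImp A B) = StrictNonimp A B"
| "sneg (StrictNonimp A B) = StrictImp A B"

type_synonym 'a valuation = "'a \<Rightarrow> bool"

primrec eval :: "'a valuation \<Rightarrow> 'a form \<Rightarrow> bool" where
  "eval w (Atom p) = w p"
| "eval w (Neg A) = (\<not> eval w A)"
| "eval w (Conj A B) = (eval w A \<and> eval w B)"
| "eval w (Disj A B) = (eval w A \<or> eval w B)"
| "eval w (Imp A B) = (eval w A \<longrightarrow> eval w B)"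

definition is_frame :: "'a valuation set \<Rightarrow> bool" where
  "is_frame R \<longleftrightarrow> R \<noteq> {}"

primrec satisfies :: "'a valuation set \<Rightarrow> 'a sform \<Rightarrow> bool" where
  "satisfies R (StrictImp A B) = (\<forall>w\<in>R. \<not> eval w A \<or> eval w B)"
| "satisfies R (StrictNonimp A B) = (\<exists>w\<in>R. eval w A \<and> \<not> eval w B)"

definition satisfies_theory :: "'a valuation set \<Rightarrow> 'a sform set \<Rightarrow> bool" where
  "satisfies_theory R \<Gamma> \<longleftrightarrow> (\<forall>\<psi>\<in>\<Gamma>. satisfies R \<psi>)"

definition strict_consequence :: "'a sform set \<Rightarrow> 'a sform \<Rightarrow> bool" where
  "strict_consequence \<Gamma> \<phi> \<longleftrightarrow>
     (\<forall>R. is_frame R \<longrightarrow> satisfies_theory R \<Gamma> \<longrightarrow> satisfies R \<phi>)"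

datatype ('a, 'w) tform =
    SForm "'a sform"
  | At "'a form" 'w

type_synonym ('a, 'w) label = "('a, 'w) tform set"

definition worlds :: "('a, 'w) label \<Rightarrow> 'w set" where
  "worlds L = {w. \<exists>A. At A w \<in> L}"

text \<open>
  In \<open>expands P L Ls\<close>, \<open>L\<close> is the label of a node, \<open>Ls\<close> lists the labels of its children, and
  \<open>P\<close> is the set of labels of the node and its ancestors, used only for the freshness condition.
  Since \<open>D\<close> may or may not contain the principal formula, a rule application may either keep
  or discard that formula.
\<close>

inductive expands :: "('a, 'w) label set \<Rightarrow> ('a, 'w) label \<Rightarrow> ('a, 'w) label list \<Rightarrow> bool"
  for P :: "('a, 'w) label set"
where
  Disj: "expands P (insert (At (Disj A B) w) D) [insert (At A w) D, insert (At B w) D]"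
| NegDisj: "expands P (insert (At (Neg (Disj A B)) w) D)
    [insert (At (Neg A) w) (insert (At (Neg B) w) D)]"
| Conj: "expands P (insert (At (Conj A B) w) D) [insert (At A w) (insert (At B w) D)]"
| NegConj: "expands P (insert (At (Neg (Conj A B)) w) D)
    [insert (At (Neg A) w) D, insert (At (Neg B) w) D]"
| Imp: "expands P (insert (At (Imp A B) w) D) [insert (At (Neg A) w) D, insert (At B w) D]"
| NegImp: "expands P (insert (At (Neg (Imp A B)) w) D)
    [insert (At A w) (insert (At (Neg B) w) D)]"
| StrictImp: "expands P (insert (SForm (StrictImp A B)) D)
    [insert (At (Neg A) w) D, insert (At B w) D]"
| StrictNonimp: "(\<forall>M\<in>P. v \<notin> worlds M) \<Longrightarrow>
    expands P (insert (SForm (StrictNonimp A B)) D)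
      [insert (At A v) (insert (At (Neg B) v) D)]"
| Cut: "expands P D [insert (At A w) D, insert (At (Neg A) w) D]"
| NegNeg: "expands P (insert (At (Neg (Neg A)) w) D) [insert (At A w) D]"

datatype ('a, 'w) ltree = Node (root_label: "('a, 'w) label") (children: "('a, 'w) ltree list")

text \<open>
  \<open>wf_subtree P t\<close>: the tree \<open>t\<close> is correctly built when placed below nodes whose labels form
  the set \<open>P\<close>.
\<close>

inductive wf_subtree :: "('a, 'w) label set \<Rightarrow> ('a, 'w) ltree \<Rightarrow> bool" where
  leaf: "wf_subtree P (Node L [])"
| step: "expands (insert L P) L (map root_label ts) \<Longrightarrow>
    (\<forall>t\<in>set ts. wf_subtree (insert L P) t) \<Longrightarrow> wf_subtree P (Node L ts)"

definition tableau_for :: "('a, 'w) label \<Rightarrow> ('a, 'w) ltree \<Rightarrow> bool" where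
  "tableau_for L t \<longleftrightarrow> root_label t = L \<and> wf_subtree {} t"

text \<open>The maximal branches, as lists of labels from the root to a leaf.\<close>

fun max_branches :: "('a, 'w) ltree \<Rightarrow> ('a, 'w) label list set" where
  "max_branches (Node L ts) =
     (if ts = [] then {[L]} else (\<Union>t\<in>set ts. (#) L ` max_branches t))"

definition closed_branch :: "('a, 'w) label list \<Rightarrow> bool" where
  "closed_branch b \<longleftrightarrow> (\<exists>L\<in>set b. \<exists>A w. At A w \<in> L \<and> At (Neg A) w \<in> L)"

definition closed_tableau :: "('a, 'w) ltree \<Rightarrow> bool" where
  "closed_tableau t \<longleftrightarrow> (\<forall>b\<in>max_branches t. closed_branch b)"

end

theory Submission
  imports Defs "HOL-Analysis.Function_Topology"
begin

text \<open>
  Soundness is the usual argument that some child of an interpretable node is interpretable.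
  For completeness, the natural candidate for a model of a set of s-formulas is the set of all
  valuations satisfying every \<open>C \<rightarrow> D\<close> with \<open>C \<prec> D\<close> in the set. If it is not a model, then
  either it is empty or it violates some strict nonimplication of \<open>A\<close> and \<open>B\<close>, so either these
  implications alone or these implications together with \<open>A\<close> and \<open>\<not> B\<close> are propositionally
  unsatisfiable. Hence a single world suffices: by compactness finitely many of the formulas are
  already unsatisfiable, and after cuts on all their atoms every branch describes a valuation
  falsifying one of them, which the remaining rules turn into a clash.
\<close>

section \<open>Compactness of propositional logic\<close>

text \<open>Each atom reads off one coordinate, which is continuous, and the connectives are finite
  Boolean operations, so truth sets are clopen. Implication and negation exchange truth and falsity,
  hence the joint induction.\<close>

lemma openin_eval:
  "openin (product_topology (\<lambda>_. discrete_topology UNIV) UNIV) {v. eval v A}"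
  and openin_not_eval:
  "openin (product_topology (\<lambda>_. discrete_topology UNIV) UNIV) {v. \<not> eval v A}"
proof (induction A)
  case (Atom p)
  let ?T = "product_topology (\<lambda>_::'a. discrete_topology (UNIV :: bool set)) UNIV"
  have "openin ?T {v \<in> topspace ?T. v p \<in> U}" for U
    by (rule openin_continuous_map_preimage[OF continuous_map_product_projection]) auto
  from this[of "{True}"] this[of "{False}"] show "openin ?T {v. eval v (Atom p)}"
    "openin ?T {v. \<not> eval v (Atom p)}"
    by (simp_all add: PiE_def extensional_def)
next
  case (Conj A B)
  have "{v. eval v (Conj A B)} = {v. eval v A} \<inter> {v. eval v B}"
    "{v. \<not> eval v (Conj A B)} = {v. \<not> eval v A} \<union> {v. \<not> eval v B}"
    by auto
  with Conj show "openin (product_topology (\<lambda>_. discrete_topology UNIV) UNIV) {v. eval v (Conj A B)}"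
    "openin (product_topology (\<lambda>_. discrete_topology UNIV) UNIV) {v. \<not> eval v (Conj A B)}"
    by (metis openin_Int openin_Un)+
next
  case (Disj A B)
  have "{v. eval v (Disj A B)} = {v. eval v A} \<union> {v. eval v B}"
    "{v. \<not> eval v (Disj A B)} = {v. \<not> eval v A} \<inter> {v. \<not> eval v B}"
    by auto
  with Disj show "openin (product_topology (\<lambda>_. discrete_topology UNIV) UNIV) {v. eval v (Disj A B)}"
    "openin (product_topology (\<lambda>_. discrete_topology UNIV) UNIV) {v. \<not> eval v (Disj A B)}"
    by (metis openin_Int openin_Un)+
next
  case (Imp A B)
  have "{v. eval v (Imp A B)} = {v. \<not> eval v A} \<union> {v. eval v B}"
    "{v. \<not> eval v (Imp A B)} = {v. eval v A} \<inter> {v. \<not> eval v B}"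
    by auto
  with Imp show "openin (product_topology (\<lambda>_. discrete_topology UNIV) UNIV) {v. eval v (Imp A B)}"
    "openin (product_topology (\<lambda>_. discrete_topology UNIV) UNIV) {v. \<not> eval v (Imp A B)}"
    by (metis openin_Int openin_Un)+
qed simp_all

text \<open>By Tychonoff the space of valuations is compact. The truth sets of the members of
  \<open>S\<close> are closed, and \<open>fin\<close> is their finite intersection property.\<close>

lemma propositional_compactness:
  assumes fin: "\<And>F. finite F \<Longrightarrow> F \<subseteq> S \<Longrightarrow> \<exists>v. \<forall>A\<in>F. eval v A"
  shows "\<exists>v. \<forall>A\<in>S. eval v A"
proof -
  let ?T = "product_topology (\<lambda>_::'a. discrete_topology (UNIV :: bool set)) UNIV"
  let ?M = "\<lambda>A. {v. eval v A}"
  have "compact_space ?T"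
    by (simp add: compact_space_product_topology compact_space_discrete_topology)
  moreover have "\<forall>C\<in>?M ` S. closedin ?T C"
    using openin_not_eval by (auto simp: closedin_def Diff_eq Collect_neg_eq[symmetric])
  moreover have "\<forall>\<F>. finite \<F> \<and> \<F> \<subseteq> ?M ` S \<longrightarrow> \<Inter>\<F> \<noteq> {}"
  proof (intro allI impI, elim conjE)
    fix \<F> assume sub: "finite \<F>" "\<F> \<subseteq> ?M ` S"
    obtain F where F: "F \<subseteq> S" "finite F" "\<F> = ?M ` F"
      using finite_subset_image[OF sub] by blast
    then show "\<Inter>\<F> \<noteq> {}" using fin[of F] by auto
  qed
  ultimately have "\<Inter>(?M ` S) \<noteq> {}"
    using compact_space_fip[of ?T] by presburger
  then show ?thesis by auto
qed

section \<open>Soundness\<close>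

text \<open>The assignment \<open>g\<close> is total with range in \<open>R\<close>, so the rule for
  strict implications is sound at every world variable, mentioned or not.\<close>

definition interprets ::
    "'a valuation set \<Rightarrow> ('w \<Rightarrow> 'a valuation) \<Rightarrow> ('a, 'w) label \<Rightarrow> bool" where
  "interprets R g L \<longleftrightarrow> range g \<subseteq> R \<and> (\<forall>A w. At A w \<in> L \<longrightarrow> eval (g w) A) \<and>
     (\<forall>\<psi>. SForm \<psi> \<in> L \<longrightarrow> satisfies R \<psi>)"

lemma interprets_insert_At [simp]:
  "interprets R g (insert (At A w) L) \<longleftrightarrow> eval (g w) A \<and> interprets R g L"
  by (auto simp: interprets_def)

lemma interprets_insert_SForm [simp]:
  "interprets R g (insert (SForm \<psi>) L) \<longleftrightarrow> satisfies R \<psi> \<and> interprets R g L"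
  by (auto simp: interprets_def)

lemma interprets_update_fresh:
  assumes "interprets R g L" "v \<notin> worlds L" "u \<in> R"
  shows "interprets R (g(v := u)) L"
  using assms by (auto simp: interprets_def worlds_def)

lemma interprets_no_clash:
  assumes "interprets R g L" "At A w \<in> L"
  shows "At (Neg A) w \<notin> L"
proof
  assume "At (Neg A) w \<in> L"
  with assms have "eval (g w) (Neg A)" "eval (g w) A"
    unfolding interprets_def by blast+
  then show False by simp
qed

text \<open>Only the rule for strict nonimplications changes \<open>g\<close>: it sends the new
  world variable to a witness in \<open>R\<close>. The other rules keep \<open>g\<close>.\<close>

lemma expands_interprets:
  assumes "expands P L Ls" "L \<in> P" "interprets R g L"
  shows "\<exists>L'\<in>set Ls. \<exists>g'. interprets R g' L'"
  using assms
proof cases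
  case (StrictImp A B D w)
  then have "g w \<in> R" "satisfies R (StrictImp A B)" "interprets R g D"
    using assms by (auto simp: interprets_def)
  then have "interprets R g (insert (At (Neg A) w) D) \<or> interprets R g (insert (At B w) D)"
    by auto
  then show ?thesis using StrictImp by auto
next
  case (StrictNonimp v A B D)
  then obtain u where "u \<in> R" "eval u A" "\<not> eval u B"
    using assms by auto
  \<comment> \<open>Freshness is stated for the labels in \<open>P\<close>; it reaches
    \<open>L\<close> through \<open>L \<in> P\<close>.\<close>
  moreover have "v \<notin> worlds L" using StrictNonimp assms by blast
  moreover have "interprets R g D" "worlds D \<subseteq> worlds L"
    using StrictNonimp assms by (auto simp: worlds_def)
  ultimately have "interprets R (g(v := u)) (insert (At A v) (insert (At (Neg B) v) D))"
    using interprets_update_fresh[of R g D v u] by auto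
  then show ?thesis using StrictNonimp by (metis list.set_intros(1))
qed auto

text \<open>Descending always to an interpretable child gives a branch without a clash. The frame
  stays fixed while \<open>g\<close> may change at each node, so the induction generalizes over
  \<open>g\<close>.\<close>

lemma interprets_open_branch:
  assumes "wf_subtree P t" "interprets R g (root_label t)"
  shows "\<exists>b\<in>max_branches t. \<not> closed_branch b"
  using assms
proof (induction arbitrary: g rule: wf_subtree.induct)
  case (leaf P L)
  then show ?case by (auto simp: closed_branch_def dest: interprets_no_clash)
next
  case (step L P ts)
  have "\<exists>t\<in>set ts. \<exists>g'. interprets R g' (root_label t)"
    using expands_interprets[OF step.hyps, of R g] step.prems by auto
  then obtain t g' where t: "t \<in> set ts" "interprets R g' (root_label t)"
    by blast
  then obtain b where b: "b \<in> max_branches t" "\<not> closed_branch b"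
    using step.IH by blast
  have "\<not> closed_branch (L # b)"
    using b(2) step.prems by (auto simp: closed_branch_def dest: interprets_no_clash)
  moreover have "L # b \<in> max_branches (Node L ts)"
    using t(1) b(1) by auto
  ultimately show ?case by blast
qed

section \<open>Completeness\<close>

definition closable :: "('a, 'w) label set \<Rightarrow> ('a, 'w) label \<Rightarrow> bool" where
  "closable P L \<longleftrightarrow> (\<exists>t. root_label t = L \<and> wf_subtree P t \<and> closed_tableau t)"

lemma closable_clash:
  assumes "At A w \<in> L" "At (Neg A) w \<in> L"
  shows "closable P L"
  unfolding closable_def using assms
  by (intro exI[of _ "Node L []"]) (auto simp: closed_tableau_def closed_branch_def intro: leaf)

lemma closable_expands:
  assumes exp: "expands (insert L P) L Ls" and "Ls \<noteq> []"
    and "\<forall>L'\<in>set Ls. closable (insert L P) L'"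
  shows "closable P L"
proof -
  \<comment> \<open>One closed subtree is chosen per label, so mapping \<open>f\<close> over
    \<open>Ls\<close> yields the children in the right order.\<close>
  obtain f where f: "\<forall>L'\<in>set Ls. root_label (f L') = L' \<and> wf_subtree (insert L P) (f L') \<and>
      closed_tableau (f L')"
    using assms(3) unfolding closable_def by metis
  let ?ts = "map f Ls"
  have "map root_label ?ts = Ls"
    using f by (simp add: map_idI)
  then have "wf_subtree P (Node L ?ts)"
    using exp f by (intro step) auto
  moreover have "closed_tableau (Node L ?ts)"
    using f \<open>Ls \<noteq> []\<close> by (auto simp: closed_tableau_def closed_branch_def)
  ultimately show ?thesis unfolding closable_def by (metis ltree.sel(1))
qed

text \<open>Opposite literals are not excluded, so the property survives every enlargement of the
  label.\<close>

definition decides :: "('a, 'w) label \<Rightarrow> 'w \<Rightarrow> 'a valuation \<Rightarrow> 'a set \<Rightarrow> bool" where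
  "decides L w v X \<longleftrightarrow>
     (\<forall>p\<in>X. if v p then At (Atom p) w \<in> L else At (Neg (Atom p)) w \<in> L)"

lemma decides_mono: "decides L w v X \<Longrightarrow> L \<subseteq> L' \<Longrightarrow> Y \<subseteq> X \<Longrightarrow> decides L' w v Y"
  unfolding decides_def by (auto split: if_splits)

text \<open>Each rule passes the conflict with \<open>v\<close> on to an immediate subformula in
  every child, down to an atom, where the literal in \<open>L\<close> gives a clash. Falsity of a
  negation is truth of its body, so the two claims need each other.\<close>

lemma closable_false_formula:
  "decides L w v (set_form A) \<Longrightarrow> At A w \<in> L \<Longrightarrow> \<not> eval v A \<Longrightarrow> closable P L"
  and closable_true_negation:
  "decides L w v (set_form A) \<Longrightarrow> At (Neg A) w \<in> L \<Longrightarrow> eval v A \<Longrightarrow> closable P L"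
proof (induction A arbitrary: L P)
  case (Atom p)
  {
    case 1
    then show ?case by (intro closable_clash[of "Atom p" w]) (auto simp: decides_def)
  next
    case 2
    then show ?case by (intro closable_clash[of "Atom p" w]) (auto simp: decides_def)
  }
next
  case (Neg A)
  {
    case 1
    then show ?case using Neg.IH(2) by auto
  next
    case 2
    \<comment> \<open>Taking \<open>D\<close> to be \<open>L\<close> itself, by
      \<open>insert_absorb\<close>, keeps the principal formula; labels only grow and
      \<open>decides\<close> is preserved.\<close>
    then show ?case
      using closable_expands[OF expands.NegNeg[of "insert L P" A w L, unfolded insert_absorb[OF 2(2)]]]
        Neg.IH(1)[of "insert (At A w) L"] by (auto intro: decides_mono)
  }
next
  case (Conj A B)
  {
    case 1
    let ?L = "insert (At A w) (insert (At B w) L)"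
    have "decides ?L w v (set_form A)" "decides ?L w v (set_form B)"
      using 1(1) by (auto intro: decides_mono)
    then show ?case
      using closable_expands[OF expands.Conj[of "insert L P" A B w L, unfolded insert_absorb[OF 1(2)]]]
        Conj.IH(1,3)[of ?L] 1(3) by auto
  next
    case 2
    have "decides (insert (At (Neg A) w) L) w v (set_form A)"
      "decides (insert (At (Neg B) w) L) w v (set_form B)"
      using 2(1) by (auto intro: decides_mono)
    then show ?case
      using closable_expands[OF expands.NegConj[of "insert L P" A B w L, unfolded insert_absorb[OF 2(2)]]]
        Conj.IH(2,4) 2(3) by auto
  }
next
  case (Disj A B)
  {
    case 1
    have "decides (insert (At A w) L) w v (set_form A)"
      "decides (insert (At B w) L) w v (set_form B)"
      using 1(1) by (auto intro: decides_mono)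
    then show ?case
      using closable_expands[OF expands.Disj[of "insert L P" A B w L, unfolded insert_absorb[OF 1(2)]]]
        Disj.IH(1,3) 1(3) by auto
  next
    case 2
    let ?L = "insert (At (Neg A) w) (insert (At (Neg B) w) L)"
    have "decides ?L w v (set_form A)" "decides ?L w v (set_form B)"
      using 2(1) by (auto intro: decides_mono)
    then show ?case
      using closable_expands[OF expands.NegDisj[of "insert L P" A B w L, unfolded insert_absorb[OF 2(2)]]]
        Disj.IH(2,4)[of ?L] 2(3) by auto
  }
next
  case (Imp A B)
  {
    case 1
    have "decides (insert (At (Neg A) w) L) w v (set_form A)"
      "decides (insert (At B w) L) w v (set_form B)"
      using 1(1) by (auto intro: decides_mono)
    then show ?case
      using closable_expands[OF expands.Imp[of "insert L P" A B w L, unfolded insert_absorb[OF 1(2)]]]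
        Imp.IH(2,3) 1(3) by auto
  next
    case 2
    let ?L = "insert (At A w) (insert (At (Neg B) w) L)"
    have "decides ?L w v (set_form A)" "decides ?L w v (set_form B)"
      using 2(1) by (auto intro: decides_mono)
    then show ?case
      using closable_expands[OF expands.NegImp[of "insert L P" A B w L, unfolded insert_absorb[OF 2(2)]]]
        Imp.IH(1,4)[of ?L] 2(3) by auto
  }
qed

text \<open>Here \<open>v\<close> makes \<open>C\<close> true and \<open>D\<close> false, so
  applying the rule at \<open>w\<close> puts a formula false under \<open>v\<close> into either
  child.\<close>

lemma closable_false_strict_implication:
  assumes dec: "decides L w v (set_form (Imp C D))" and mem: "SForm (StrictImp C D) \<in> L"
    and "\<not> eval v (Imp C D)"
  shows "closable P L"
proof -
  have "decides (insert (At (Neg C) w) L) w v (set_form C)"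
    "decides (insert (At D w) L) w v (set_form D)"
    using dec by (auto intro: decides_mono)
  then have "closable (insert L P) (insert (At (Neg C) w) L)"
    "closable (insert L P) (insert (At D w) L)"
    using assms(3) by (auto intro: closable_true_negation closable_false_formula)
  then show ?thesis
    using closable_expands[OF expands.StrictImp[of "insert L P" C D L w, unfolded insert_absorb[OF mem]]]
    by auto
qed

lemma finite_atoms: "finite (set_form A)"
  by (induction A) auto

text \<open>Cutting on the atoms of \<open>X\<close> one after another makes every branch decide
  \<open>X\<close> by some valuation. The premise covers all larger labels and all ancestor sets
  because both grow along the way.\<close>

lemma closable_by_cuts:
  assumes "finite X"
    and "\<And>P' L' v. L \<subseteq> L' \<Longrightarrow> decides L' w v X \<Longrightarrow> closable P' L'"
  shows "closable P L"
  using assms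
proof (induction arbitrary: P rule: finite_induct)
  case empty
  then show ?case by (auto simp: decides_def)
next
  case (insert x X)
  show ?case
  \<comment> \<open>The cut on \<open>x\<close> is placed below those on \<open>X\<close>. As
    \<open>x\<close> lies outside \<open>X\<close>, updating \<open>v\<close> at \<open>x\<close>
    leaves the earlier decisions intact.\<close>
  proof (rule insert.IH)
    fix P' L' v assume L': "L \<subseteq> L'" and dec: "decides L' w v X"
    have "decides (insert (At (Atom x) w) L') w (v(x := True)) (insert x X)"
      "decides (insert (At (Neg (Atom x)) w) L') w (v(x := False)) (insert x X)"
      using dec insert.hyps by (auto simp: decides_def)
    then have "closable (insert L' P') (insert (At (Atom x) w) L')"
      "closable (insert L' P') (insert (At (Neg (Atom x)) w) L')"
      using L' by (auto intro: insert.prems)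
    then show "closable P' L'"
      using closable_expands[OF expands.Cut[of "insert L' P'" L' "Atom x" w]] by auto
  qed
qed

text \<open>The label may be infinite, but compactness leaves a finite \<open>F\<close> to refute,
  so finitely many cuts suffice. On each branch the described valuation falsifies a member of
  \<open>F\<close>.\<close>

lemma closable_if_unsatisfiable_at:
  assumes unsat: "\<nexists>v. (\<forall>A. At A w \<in> L \<longrightarrow> eval v A) \<and>
    (\<forall>C D. SForm (StrictImp C D) \<in> L \<longrightarrow> eval v (Imp C D))"
  shows "closable P L"
proof -
  let ?S = "{A. At A w \<in> L} \<union> {Imp C D |C D. SForm (StrictImp C D) \<in> L}"
  have "\<nexists>v. \<forall>A\<in>?S. eval v A"
    using unsat by blast
  then obtain F where F: "finite F" "F \<subseteq> ?S" "\<nexists>v. \<forall>A\<in>F. eval v A"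
    using propositional_compactness[of ?S] by blast
  show ?thesis
  proof (rule closable_by_cuts)
    show "finite (\<Union>A\<in>F. set_form A)"
      using F(1) finite_atoms by blast
  next
    fix P' L' v assume L': "L \<subseteq> L'" and dec: "decides L' w v (\<Union>A\<in>F. set_form A)"
    obtain A where A: "A \<in> F" "\<not> eval v A"
      using F(3) by blast
    have "decides L' w v (set_form A)"
      using A(1) dec by (auto intro: decides_mono)
    consider "At A w \<in> L'" | C D where "A = Imp C D" "SForm (StrictImp C D) \<in> L'"
      using A(1) F(2) L' by blast
    then show "closable P' L'"
    proof cases
      case 1
      then show ?thesis
        using \<open>decides L' w v (set_form A)\<close> A(2) by (intro closable_false_formula)
    next
      case 2
      then show ?thesis
        using \<open>decides L' w v (set_form A)\<close> A(2) by (metis closable_false_strict_implication)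
    qed
  qed
qed

lemma closable_if_unsatisfiable:
  fixes \<Delta> :: "'a sform set"
  assumes unsat: "\<And>R. is_frame R \<Longrightarrow> \<not> satisfies_theory R \<Delta>"
  shows "closable {} (SForm ` \<Delta> :: ('a, 'w) label)"
proof -
  let ?L = "SForm ` \<Delta> :: ('a, 'w) label"
  \<comment> \<open>This is the largest set satisfying all strict implications of
    \<open>\<Delta>\<close>. Enlarging a frame preserves nonimplications, so \<open>R\<close> is a
    model if any frame is.\<close>
  define R where "R = {v. \<forall>C D. StrictImp C D \<in> \<Delta> \<longrightarrow> eval v (Imp C D)}"
  fix w :: 'w
  show ?thesis
  proof (cases "R = {}")
    case True
    then show ?thesis
      by (intro closable_if_unsatisfiable_at[of w]) (auto simp: R_def image_iff)
  next
    case False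
    then obtain \<psi> where psi: "\<psi> \<in> \<Delta>" "\<not> satisfies R \<psi>"
      using unsat[of R] by (auto simp: is_frame_def satisfies_theory_def)
    show ?thesis
    proof (cases \<psi>)
      case (StrictImp A B)
      then show ?thesis using psi by (auto simp: R_def)
    next
      case (StrictNonimp A B)
      have mem: "SForm (StrictNonimp A B) \<in> ?L"
        using psi(1) StrictNonimp by auto
      \<comment> \<open>The root label holds only s-formulas, so every world variable is new
        there.\<close>
      have "expands {?L} ?L [insert (At A w) (insert (At (Neg B) w) ?L)]"
        using expands.StrictNonimp[of "{?L}" w A B ?L, unfolded insert_absorb[OF mem]]
        by (auto simp: worlds_def)
      \<comment> \<open>A valuation meeting all requirements at \<open>w\<close> would lie in
        \<open>R\<close> and witness the violated nonimplication.\<close>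
      moreover have "closable {?L} (insert (At A w) (insert (At (Neg B) w) ?L))"
        using psi(2) StrictNonimp
        by (intro closable_if_unsatisfiable_at[of w]) (auto simp: R_def)
      ultimately show ?thesis
        by (intro closable_expands) auto
    qed
  qed
qed

section \<open>Strict consequence as unsatisfiability, and the equivalence\<close>

lemma satisfies_sneg: "satisfies R (sneg \<phi>) \<longleftrightarrow> \<not> satisfies R \<phi>"
  by (cases \<phi>) auto

lemma strict_consequence_iff_unsatisfiable:
  "strict_consequence \<Gamma> \<phi> \<longleftrightarrow> (\<forall>R. is_frame R \<longrightarrow> \<not> satisfies_theory R (\<Gamma> \<union> {sneg \<phi>}))"
  by (auto simp: strict_consequence_def satisfies_theory_def satisfies_sneg)

theorem theorem12:
  fixes \<Gamma> :: "'a sform set" and \<phi> :: "'a sform"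
  assumes "infinite (UNIV :: 'a set)"
    and "infinite (UNIV :: 'w set)"
  shows "strict_consequence \<Gamma> \<phi> \<longleftrightarrow>
    (\<exists>t :: ('a, 'w) ltree. tableau_for (SForm ` (\<Gamma> \<union> {sneg \<phi>})) t \<and> closed_tableau t)"
proof
  assume "strict_consequence \<Gamma> \<phi>"
  then have "closable {} (SForm ` (\<Gamma> \<union> {sneg \<phi>}) :: ('a, 'w) label)"
    unfolding strict_consequence_iff_unsatisfiable by (intro closable_if_unsatisfiable) blast
  then show "\<exists>t :: ('a, 'w) ltree. tableau_for (SForm ` (\<Gamma> \<union> {sneg \<phi>})) t \<and> closed_tableau t"
    unfolding closable_def tableau_for_def by blast
next
  assume "\<exists>t :: ('a, 'w) ltree. tableau_for (SForm ` (\<Gamma> \<union> {sneg \<phi>})) t \<and> closed_tableau t"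
  then obtain t :: "('a, 'w) ltree" where t: "root_label t = SForm ` (\<Gamma> \<union> {sneg \<phi>})"
    "wf_subtree {} t" "closed_tableau t"
    unfolding tableau_for_def by blast
  show "strict_consequence \<Gamma> \<phi>"
    unfolding strict_consequence_iff_unsatisfiable
  proof (intro allI impI notI)
    fix R :: "'a valuation set"
    assume "is_frame R" and sat: "satisfies_theory R (\<Gamma> \<union> {sneg \<phi>})"
    then obtain u where "u \<in> R" by (auto simp: is_frame_def)
    \<comment> \<open>The root label mentions no world variable, so a constant assignment into the
      nonempty \<open>R\<close> will do.\<close>
    then have "interprets R (\<lambda>_. u) (root_label t)"
      using sat by (auto simp: t(1) interprets_def satisfies_theory_def)
    then show False
      using interprets_open_branch[OF t(2)] t(3) by (auto simp: closed_tableau_def)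
  qed
qed

end
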